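(* (Riemann–Roch theorem on a weighted finite graph.) Let $G=(V_G,E_G)$ be a finite connected weighted graph as described in the context. For every divisor $D$ on $G$, $$r(D)-r(K_G-D)=\deg(D)+\mathfrak e_{(G,C)}.$$
   Context: $G=(V_G,E_G)$ is a connected graph with finite vertex set, no loops, edges unordered pairs of distinct vertices, each edge $\{x,y\}$ with positive rational weight $C_{x,y}=C_{y,x}$; $N(x)=\{y:\{x,y\}\in E_G\}$. For $f:V_G\to\mathbb Z$, $\Delta f(x)=\sum_{y\in N(x)}C_{x,y}(f(x)-f(y))$. $i(x)=\min\{|\Delta f(x)|: f:V_G\to\mathbb Z,\ f(x)=0,\ \Delta f(x)\ne0\}$. A divisor is $D=\sum_x\ell(x)i(x)1_{\{x\}}$ with $\ell:V_G\to\mathbb Z$; $\deg D=\sum_x\ell(x)i(x)$; effective means $\ell\ge0$. $D\sim D'$ iff $D'=D+\Delta f$ for some $f:V_G\to\mathbb Z$. $|D|=\{D':D'\text{ effective},\ D'\sim D\}$. The canonical divisor is $K_G=\sum_x\big(\sum_{y\in N(x)}C_{x,y}-2i(x)\big)1_{\{x\}}$, and $\mathfrak e_{(G,C)}=\sum_{x\in V_G}i(x)-\sum_{\{x,y\}\in E_G}C_{x,y}$. Let $i_{(G,C)}=\min\{|\sum_x\ell(x)i(x)|>0:\ell:V_G\to\mathbb Z\}$. For $k\ge0$ let $E_k(D)$ be the set of effective divisors $E$ with $\deg E=k\,i_{(G,C)}$ and $|D-E|\ne\emptyset$. Define $r(D)=-i_{(G,C)}$ if $E_0(D)=\emptyset$,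 and otherwise $r(D)=\max\{k\,i_{(G,C)}: E_k(D)\text{ consists of all effective divisors of degree }k\,i_{(G,C)}\}$.
   Formalization: r(D) is the largest k·i_(G,C) such that for every j≤k, E_j(D) is all effective divisors of degree j·i_(G,C); testing degree k alone makes the formula false if no vertex has i(x)=i_(G,C), else it agrees. G has at least two vertices, since i(x) is undefined for one. *)

theory Defs
  imports Complex_Main
begin

record 'a wgraph =
  verts :: "'a set"
  edges :: "'a set set"
  weight :: "'a set \<Rightarrow> rat"

text \<open>
  The weight is a function of the unordered edge \<open>{x, y}\<close>, so its symmetry is built in.
  A one-vertex graph has no function with nonzero Laplacian, so that the minimum defining
  \<open>local_unit\<close> would range over the empty set; hence the bound on the number of vertices.
\<close>

definition weighted_graph :: "'a wgraph \<Rightarrow> bool" where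
  "weighted_graph G \<longleftrightarrow>
     finite (verts G) \<and> 2 \<le> card (verts G) \<and>
     (\<forall>e\<in>edges G. \<exists>x\<in>verts G. \<exists>y\<in>verts G. x \<noteq> y \<and> e = {x, y}) \<and>
     (\<forall>e\<in>edges G. 0 < weight G e) \<and>
     (\<forall>x\<in>verts G. \<forall>y\<in>verts G. (x, y) \<in> {(u, v). {u, v} \<in> edges G}\<^sup>*)"

definition nbrs :: "'a wgraph \<Rightarrow> 'a \<Rightarrow> 'a set" where
  "nbrs G x = {y. {x, y} \<in> edges G}"

definition laplacian :: "'a wgraph \<Rightarrow> ('a \<Rightarrow> int) \<Rightarrow> 'a \<Rightarrow> rat" where
  "laplacian G f x = (\<Sum>y\<in>nbrs G x. weight G {x, y} * of_int (f x - f y))"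

definition local_unit :: "'a wgraph \<Rightarrow> 'a \<Rightarrow> rat" where
  "local_unit G x =
     (LEAST q. \<exists>f :: 'a \<Rightarrow> int. f x = 0 \<and> laplacian G f x \<noteq> 0 \<and> q = \<bar>laplacian G f x\<bar>)"

text \<open>Divisors are extended by \<open>0\<close> outside the vertex set, as are Laplacians automatically.\<close>

definition divisor_of :: "'a wgraph \<Rightarrow> ('a \<Rightarrow> int) \<Rightarrow> 'a \<Rightarrow> rat" where
  "divisor_of G l x = (if x \<in> verts G then of_int (l x) * local_unit G x else 0)"

definition divisor :: "'a wgraph \<Rightarrow> ('a \<Rightarrow> rat) \<Rightarrow> bool" where
  "divisor G D \<longleftrightarrow> (\<exists>l. D = divisor_of G l)"

definition effective :: "'a wgraph \<Rightarrow> ('a \<Rightarrow> rat) \<Rightarrow> bool" where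
  "effective G D \<longleftrightarrow> (\<exists>l. (\<forall>x\<in>verts G. 0 \<le> l x) \<and> D = divisor_of G l)"

definition deg :: "'a wgraph \<Rightarrow> ('a \<Rightarrow> rat) \<Rightarrow> rat" where
  "deg G D = (\<Sum>x\<in>verts G. D x)"

definition lin_equiv :: "'a wgraph \<Rightarrow> ('a \<Rightarrow> rat) \<Rightarrow> ('a \<Rightarrow> rat) \<Rightarrow> bool" where
  "lin_equiv G D D' \<longleftrightarrow> (\<exists>f :: 'a \<Rightarrow> int. D' = (\<lambda>x. D x + laplacian G f x))"

definition linear_system :: "'a wgraph \<Rightarrow> ('a \<Rightarrow> rat) \<Rightarrow> ('a \<Rightarrow> rat) set" where
  "linear_system G D = {D'. effective G D' \<and> lin_equiv G D D'}"

definition canonical :: "'a wgraph \<Rightarrow> 'a \<Rightarrow> rat" where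
  "canonical G x =
     (if x \<in> verts G then (\<Sum>y\<in>nbrs G x. weight G {x, y}) - 2 * local_unit G x else 0)"

definition euler :: "'a wgraph \<Rightarrow> rat" where
  "euler G = (\<Sum>x\<in>verts G. local_unit G x) - (\<Sum>e\<in>edges G. weight G e)"

definition global_unit :: "'a wgraph \<Rightarrow> rat" where
  "global_unit G =
     (LEAST q. 0 < q \<and> (\<exists>l :: 'a \<Rightarrow> int. q = \<bar>\<Sum>x\<in>verts G. of_int (l x) * local_unit G x\<bar>))"

definition eff_divisors :: "'a wgraph \<Rightarrow> nat \<Rightarrow> ('a \<Rightarrow> rat) set" where
  "eff_divisors G k = {E. effective G E \<and> deg G E = of_nat k * global_unit G}"

definition subtractable :: "'a wgraph \<Rightarrow> ('a \<Rightarrow> rat) \<Rightarrow> nat \<Rightarrow> ('a \<Rightarrow> rat) set" where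
  "subtractable G D k = {E \<in> eff_divisors G k. linear_system G (\<lambda>x. D x - E x) \<noteq> {}}"

text \<open>
  The maximum in the rank is over those \<open>k\<close> up to which every effective divisor can be
  subtracted.  Testing degree \<open>k\<close> alone gives the same set of \<open>k\<close> if some vertex has local
  unit \<open>global_unit G\<close> (lemma \<open>rank_eq_Greatest\<close>), but not in general, since then
  some degrees may carry few or no effective divisors; and with the test in degree \<open>k\<close>
  alone the Riemann--Roch formula fails.  On the triangle \<open>x, y, z\<close> with weights
  \<open>xy = 6\<close>, \<open>xz = 10\<close>, \<open>yz = 15\<close> the local units are \<open>2, 3, 5\<close>, the global unit is \<open>1\<close> and
  the Euler number is \<open>- 21\<close>.  For the divisor \<open>D = - 2\<close> at \<open>x\<close>, of rank \<open>- 1\<close>, the formula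
  asks for \<open>K - D\<close> (degree \<open>44\<close>) to have rank \<open>22\<close>, and indeed degree \<open>23\<close> fails; but degree
  \<open>24\<close> succeeds again, because every divisor of degree \<open>20\<close> is equivalent to an effective
  one: otherwise the difference of an acyclic-orientation divisor (degree \<open>21\<close>) and an
  equivalent divisor would be effective of degree \<open>1\<close>, and there is none.
\<close>

definition rank :: "'a wgraph \<Rightarrow> ('a \<Rightarrow> rat) \<Rightarrow> rat" where
  "rank G D =
     (if subtractable G D 0 = {} then - global_unit G
      else (GREATEST q. \<exists>k :: nat. q = of_nat k * global_unit G \<and>
              (\<forall>j\<le>k. subtractable G D j = eff_divisors G j)))"

lemma subtractable_Suc_imp:
  assumes "weighted_graph G" and x: "x \<in> verts G" "local_unit G x = global_unit G"
    and S: "subtractable G D (Suc k) = eff_divisors G (Suc k)"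
  shows "subtractable G D k = eff_divisors G k"
proof -
  have fin: "finite (verts G)" using assms(1) by (simp add: weighted_graph_def)
  let ?u = "\<lambda>y. if y = x then local_unit G x else 0"
  have plus: "effective G (\<lambda>y. E y + ?u y)" if E: "effective G E" for E
  proof -
    from E obtain l where l: "\<forall>y\<in>verts G. 0 \<le> l y" "E = divisor_of G l"
      unfolding effective_def by blast
    have "(\<lambda>y. E y + ?u y) = divisor_of G (l(x := l x + 1))"
      using x(1) by (auto simp: l(2) divisor_of_def fun_eq_iff algebra_simps)
    moreover have "\<forall>y\<in>verts G. 0 \<le> (l(x := l x + 1)) y"
      using l(1) by auto
    ultimately show ?thesis unfolding effective_def by blast
  qed
  have "E \<in> subtractable G D k" if E: "E \<in> eff_divisors G k" for E
  proof -
    let ?E = "\<lambda>y. E y + ?u y"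
    have "deg G ?E = deg G E + local_unit G x"
      using fin x(1) by (simp add: deg_def sum.distrib)
    then have "?E \<in> eff_divisors G (Suc k)"
      using E plus x(2) by (simp add: eff_divisors_def algebra_simps)
    then have "linear_system G (\<lambda>y. D y - ?E y) \<noteq> {}"
      using S by (auto simp: subtractable_def)
    then obtain D' f where D': "effective G D'"
        "D' = (\<lambda>y. (D y - ?E y) + laplacian G f y)"
      by (auto simp: linear_system_def lin_equiv_def)
    have "(\<lambda>y. D' y + ?u y) = (\<lambda>y. (D y - E y) + laplacian G f y)"
      by (simp add: D'(2) fun_eq_iff)
    then have "(\<lambda>y. D' y + ?u y) \<in> linear_system G (\<lambda>y. D y - E y)"
      using plus[OF D'(1)] by (auto simp: linear_system_def lin_equiv_def)
    then show ?thesis using E by (auto simp: subtractable_def)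
  qed
  then show ?thesis by (auto simp: subtractable_def)
qed

lemma rank_eq_Greatest:
  assumes "weighted_graph G" and "x \<in> verts G" "local_unit G x = global_unit G"
  shows "rank G D =
     (if subtractable G D 0 = {} then - global_unit G
      else (GREATEST q. \<exists>k :: nat. q = of_nat k * global_unit G \<and>
              subtractable G D k = eff_divisors G k))"
proof -
  have "subtractable G D j = eff_divisors G j"
    if "j \<le> k" "subtractable G D k = eff_divisors G k" for j k
    using that by (induction k rule: dec_induct) (auto dest: subtractable_Suc_imp[OF assms])
  then have "(\<forall>j\<le>k. subtractable G D j = eff_divisors G j) \<longleftrightarrow>
      subtractable G D k = eff_divisors G k" for k
    by blast
  then show ?thesis by (simp add: rank_def)
qed

end

theory Submission
  imports Defs
begin

text \<open>
  The argument follows Baker and Norine.  The rank of \<open>D\<close> plus the global unit is the least degree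
  of an effective \<open>E\<close> with \<open>|D - E|\<close> empty.  A linear order of the vertices yields a divisor
  \<open>\<nu>\<close> of degree minus the Euler number, whose value at \<open>x\<close> is the total weight to earlier
  vertices minus the local unit.  No such \<open>\<nu>\<close> is equivalent to an effective divisor, while every
  divisor \<open>D\<close> with \<open>|D|\<close> empty has \<open>|\<nu> - D|\<close> nonempty for a suitable order.  Reversing the order
  replaces \<open>\<nu>\<close> by \<open>K - \<nu>\<close>.  Hence if \<open>E\<close> is of least degree for \<open>D\<close>, then any effective
  \<open>E' \<sim> \<nu> - D + E\<close> has \<open>|K - D - E'|\<close> empty, which bounds the least degree for \<open>K - D\<close>; the
  symmetry between \<open>D\<close> and \<open>K - D\<close> turns the bound into an equality.
\<close>

section \<open>Discrete subgroups of the rationals\<close>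

lemma common_denominator:
  assumes "finite (A :: rat set)"
  shows "\<exists>d :: nat. 0 < d \<and> (\<forall>a\<in>A. of_nat d * a \<in> \<int>)"
  using assms
proof (induction A rule: finite_induct)
  case empty
  show ?case by auto
next
  case (insert a A)
  then obtain d :: nat where d: "0 < d" "\<forall>a\<in>A. of_nat d * a \<in> \<int>" by blast
  obtain m n :: int where mn: "a = of_int m / of_int n" "0 < n"
    by (metis Fract_of_int_quotient Rat_cases)
  have "of_nat (d * nat n) * a = of_int (int d * m)"
    using mn by (simp add: field_simps)
  then have "of_nat (d * nat n) * a \<in> \<int>" by (metis Ints_of_int)
  moreover have "of_nat (d * nat n) * b \<in> \<int>" if "b \<in> A" for b
  proof -
    have "of_nat (d * nat n) * b = of_nat (nat n) * (of_nat d * b)" by simp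
    then show ?thesis using d(2) that by (metis Ints_mult Ints_of_nat)
  qed
  ultimately show ?case using d(1) mn(2) by (intro exI[of _ "d * nat n"]) auto
qed

text \<open>A common denominator \<open>d\<close> turns the positive elements of \<open>H\<close>
  into naturals, so a least one exists, and division with remainder shows that it generates
  \<open>H\<close>. This gives meaning to the \<open>LEAST\<close> over rationals in
  \<open>local_unit\<close> and \<open>global_unit\<close>.\<close>

lemma Least_abs_generates:
  fixes H :: "rat set" and d :: nat
  assumes sub: "\<And>a b. a \<in> H \<Longrightarrow> b \<in> H \<Longrightarrow> a - b \<in> H"
    and h: "h \<in> H" "h \<noteq> 0"
    and d: "0 < d" "\<And>a. a \<in> H \<Longrightarrow> of_nat d * a \<in> \<int>"
  defines "u \<equiv> LEAST q. 0 < q \<and> (\<exists>a\<in>H. q = \<bar>a\<bar>)"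
  shows "0 < u" and "u \<in> H" and "\<And>a. a \<in> H \<Longrightarrow> \<exists>k :: int. a = of_int k * u"
proof -
  have zero: "0 \<in> H" using sub[OF h(1) h(1)] by simp
  have neg: "- a \<in> H" if "a \<in> H" for a using sub[OF zero that] by simp
  have add: "a + b \<in> H" if "a \<in> H" "b \<in> H" for a b
    using sub[OF that(1) neg[OF that(2)]] by simp
  have abs: "\<bar>a\<bar> \<in> H" if "a \<in> H" for a using neg[OF that] that by (cases "a \<ge> 0") auto
  let ?P = "\<lambda>n :: nat. 0 < n \<and> of_nat n / of_nat d \<in> H"
  have nat_repr: "\<exists>n. ?P n \<and> a = of_nat n / of_nat d" if a: "a \<in> H" "0 < a" for a
  proof -
    obtain z :: int where z: "of_nat d * a = of_int z" using d(2)[OF a(1)] by (auto elim: Ints_cases)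
    have "0 < (of_int z :: rat)" using d(1) a(2) z by (metis mult_pos_pos of_nat_0_less_iff)
    then have zp: "0 < z" by simp
    then have "a = of_nat (nat z) / of_nat d" using z d(1) by (simp add: field_simps)
    then show ?thesis using zp a(1) by (intro exI[of _ "nat z"]) auto
  qed
  obtain n0 where "?P n0" using nat_repr[OF abs[OF h(1)]] h(2) by auto
  define n where "n = (LEAST n. ?P n)"
  have n: "?P n" unfolding n_def by (rule LeastI[of ?P, OF \<open>?P n0\<close>])
  have u: "u = of_nat n / of_nat d" unfolding u_def
  proof (rule Least_equality)
    show "0 < (of_nat n / of_nat d :: rat) \<and> (\<exists>a\<in>H. of_nat n / of_nat d = \<bar>a\<bar>)"
      using n d(1) by (intro conjI bexI[of _ "of_nat n / of_nat d"]) auto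
  next
    fix q :: rat assume q: "0 < q \<and> (\<exists>a\<in>H. q = \<bar>a\<bar>)"
    then have "q \<in> H" using abs by auto
    then obtain m where m: "?P m" "q = of_nat m / of_nat d" using nat_repr q by blast
    have "n \<le> m" unfolding n_def by (rule Least_le) (rule m(1))
    then show "of_nat n / of_nat d \<le> q" by (simp add: m(2) divide_right_mono)
  qed
  show u0: "0 < u" using u n d(1) by simp
  show uH: "u \<in> H" using u n by simp
  have min: "u \<le> a" if a: "a \<in> H" "0 < a" for a
  proof -
    obtain m where m: "?P m" "a = of_nat m / of_nat d" using nat_repr[OF a] by blast
    have "n \<le> m" unfolding n_def by (rule Least_le) (rule m(1))
    then show ?thesis by (simp add: u m(2) divide_right_mono)
  qed
  have nmul: "of_nat k * u \<in> H" for k :: nat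
  proof (induction k)
    case 0
    show ?case using zero by simp
  next
    case (Suc k)
    then show ?case using add[OF uH Suc] by (simp add: distrib_right)
  qed
  have mul: "of_int k * u \<in> H" for k :: int
  proof (cases "k \<ge> 0")
    case True
    then show ?thesis using nmul[of "nat k"] by simp
  next
    case False
    then have "of_int k * u = - (of_nat (nat (- k)) * u)" by simp
    then show ?thesis using neg[OF nmul[of "nat (- k)"]] by simp
  qed
  show "\<exists>k :: int. a = of_int k * u" if a: "a \<in> H" for a
  proof -
    let ?k = "\<lfloor>a / u\<rfloor>"
    let ?r = "a - of_int ?k * u"
    have rH: "?r \<in> H" by (rule sub[OF a mul])
    have "of_int ?k \<le> a / u" "a / u < of_int ?k + 1" by linarith+
    then have "0 \<le> ?r" "?r < u"
      using u0 by (simp_all only: pos_le_divide_eq pos_divide_less_eq) (simp_all add: algebra_simps)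
    \<comment> \<open>The remainder lies in \<open>H\<close> and below its least positive element,
      so it vanishes.\<close>
    then have "?r = 0" using min[OF rH] by linarith
    then show ?thesis by (intro exI[of _ ?k]) simp
  qed
qed

section \<open>Domination and burning on finite sets\<close>

lemma ex_multiple_dominating:
  assumes "finite A" "\<And>x. x \<in> A \<Longrightarrow> 0 < (a x :: rat)"
  shows "\<exists>n :: nat. \<forall>x\<in>A. b x < of_nat n * a x"
  using assms
proof (induction A rule: finite_induct)
  case empty
  show ?case by simp
next
  case (insert z A)
  then obtain n where n: "\<forall>x\<in>A. b x < of_nat n * a x" by auto
  obtain m where m: "b z < of_nat m * a z" using ex_less_of_nat_mult[of "a z" "b z"] insert by auto
  have "b x < of_nat (max n m) * a x" if "x \<in> insert z A" for x
  proof -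
    have "0 < a x" using insert that by blast
    then have "of_nat n * a x \<le> of_nat (max n m) * a x" "of_nat m * a x \<le> of_nat (max n m) * a x"
      by (simp_all add: mult_right_mono)
    then show ?thesis using n m that by force
  qed
  then show ?case by blast
qed

text \<open>Dhar's burning process: \<open>V\<close> outside \<open>A\<close> is on fire, and a
  vertex burns once its weight to burnt vertices exceeds \<open>d\<close>. The hypothesis, read for
  the unburnt set \<open>B\<close>, says that the fire never stops; \<open>p\<close> records the
  time of burning.\<close>

lemma burning_order:
  fixes d :: "'a \<Rightarrow> rat" and w :: "'a \<Rightarrow> 'a \<Rightarrow> rat"
  assumes "finite A"
    and "\<And>B. B \<subseteq> A \<Longrightarrow> B \<noteq> {} \<Longrightarrow> \<exists>x\<in>B. d x < (\<Sum>y\<in>{y\<in>V. y \<notin> B}. w x y)"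
  shows "\<exists>p :: 'a \<Rightarrow> nat. inj_on p A \<and>
           (\<forall>x\<in>A. d x < (\<Sum>y\<in>{y\<in>V. y \<notin> A \<or> p y < p x}. w x y))"
  using assms
proof (induction A rule: finite_psubset_induct)
  case (psubset A)
  show ?case
  proof (cases "A = {}")
    case True
    then show ?thesis by simp
  next
    case False
    then obtain x where x: "x \<in> A" "d x < (\<Sum>y\<in>{y\<in>V. y \<notin> A}. w x y)"
      using psubset.prems[of A] by auto
    have sub: "A - {x} \<subset> A" using x(1) by auto
    have "\<exists>p :: 'a \<Rightarrow> nat. inj_on p (A - {x}) \<and>
        (\<forall>z\<in>A - {x}. d z < (\<Sum>y\<in>{y\<in>V. y \<notin> A - {x} \<or> p y < p z}. w z y))"
      by (rule psubset.IH[OF sub]) (use psubset.prems in blast)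
    then obtain p :: "'a \<Rightarrow> nat" where p: "inj_on p (A - {x})"
        "\<forall>z\<in>A - {x}. d z < (\<Sum>y\<in>{y\<in>V. y \<notin> A - {x} \<or> p y < p z}. w z y)"
      by blast
    \<comment> \<open>\<open>x\<close> burns first and the rest are shifted by one, so that
      \<open>x\<close>, outside \<open>A - {x}\<close> but inside \<open>A\<close>, counts as
      earlier than every other vertex of \<open>A\<close>.\<close>
    define p' where "p' = (\<lambda>y. if y = x then 0 else Suc (p y))"
    have inj: "inj_on p' A" using p(1) by (auto simp: p'_def inj_on_def)
    have less: "d z < (\<Sum>y\<in>{y\<in>V. y \<notin> A \<or> p' y < p' z}. w z y)" if z: "z \<in> A" for z
    proof (cases "z = x")
      case True
      then have "{y\<in>V. y \<notin> A \<or> p' y < p' z} = {y\<in>V. y \<notin> A}" by (auto simp: p'_def)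
      then show ?thesis using x(2) True by simp
    next
      case False
      then have "{y\<in>V. y \<notin> A \<or> p' y < p' z} = {y\<in>V. y \<notin> A - {x} \<or> p y < p z}"
        by (auto simp: p'_def)
      then show ?thesis using p(2) z False by simp
    qed
    then show ?thesis using inj by blast
  qed
qed

section \<open>Edge weights, divisors of orders, and the Laplacian\<close>

text \<open>Extension by zero lets neighbour sums run over the fixed set \<open>verts G\<close>,
  where double sums can be exchanged.\<close>

definition wt :: "'a wgraph \<Rightarrow> 'a \<Rightarrow> 'a \<Rightarrow> rat" where
  "wt G x y = (if {x, y} \<in> edges G then weight G {x, y} else 0)"

text \<open>Baker and Norine's divisor of an acyclic orientation, indegree minus one, with weights
  in place of edge counts and the local unit in place of one. Integer labels allow the reversed
  order to be \<open>- p\<close>.\<close>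

definition order_divisor :: "'a wgraph \<Rightarrow> ('a \<Rightarrow> int) \<Rightarrow> 'a \<Rightarrow> rat" where
  "order_divisor G p x =
     (if x \<in> verts G then (\<Sum>y\<in>{y\<in>verts G. p y < p x}. wt G x y) - local_unit G x else 0)"

context
  fixes G :: "'a wgraph"
  assumes G: "weighted_graph G"
begin

lemma finite_verts: "finite (verts G)"
  and card_verts: "2 \<le> card (verts G)"
  and edge_doubleton: "\<forall>e\<in>edges G. \<exists>x\<in>verts G. \<exists>y\<in>verts G. x \<noteq> y \<and> e = {x, y}"
  and weight_pos: "\<forall>e\<in>edges G. 0 < weight G e"
  and connected: "\<forall>x\<in>verts G. \<forall>y\<in>verts G. (x, y) \<in> {(u, v). {u, v} \<in> edges G}\<^sup>*"
  using G[unfolded weighted_graph_def] by - (elim conjE, assumption)+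

lemma edgeE:
  assumes "e \<in> edges G"
  obtains x y where "x \<in> verts G" "y \<in> verts G" "x \<noteq> y" "e = {x, y}"
  using edge_doubleton assms by blast

lemma edge_verts:
  assumes "{x, y} \<in> edges G"
  shows "x \<in> verts G" "y \<in> verts G" "x \<noteq> y"
proof -
  obtain u v where "u \<in> verts G" "v \<in> verts G" "u \<noteq> v" "{x, y} = {u, v}"
    using assms by (rule edgeE)
  then show "x \<in> verts G" "y \<in> verts G" "x \<noteq> y" by (auto simp: doubleton_eq_iff)
qed

lemma wt_nonneg: "0 \<le> wt G x y"
  using weight_pos by (simp add: wt_def less_imp_le)

lemma wt_pos: "{x, y} \<in> edges G \<Longrightarrow> 0 < wt G x y"
  using weight_pos by (simp add: wt_def)

lemma wt_commute: "wt G x y = wt G y x"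
  by (simp add: wt_def insert_commute)

lemma wt_self [simp]: "wt G x x = 0"
  using edge_verts(3)[of x x] by (auto simp: wt_def)

lemma nbrs_subset: "nbrs G x \<subseteq> verts G"
  using edge_verts by (auto simp: nbrs_def)

lemma sum_nbrs: "(\<Sum>y\<in>nbrs G x. weight G {x, y} * g y) = (\<Sum>y\<in>verts G. wt G x y * g y)"
  by (rule sum.mono_neutral_cong_left[OF finite_verts nbrs_subset]) (auto simp: wt_def nbrs_def)

lemma laplacian_wt: "laplacian G f x = (\<Sum>y\<in>verts G. wt G x y * of_int (f x - f y))"
  unfolding laplacian_def by (rule sum_nbrs)

lemma laplacian_outside: "x \<notin> verts G \<Longrightarrow> laplacian G f x = 0"
  using edge_verts by (auto simp: laplacian_def nbrs_def intro!: sum.neutral)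

lemma laplacian_add: "laplacian G (\<lambda>x. f x + g x) x = laplacian G f x + laplacian G g x"
  unfolding laplacian_def sum.distrib[symmetric]
  by (rule sum.cong[OF refl]) (simp add: algebra_simps)

lemma laplacian_mult: "laplacian G (\<lambda>x. c * f x) x = of_int c * laplacian G f x"
  by (simp add: laplacian_def sum_distrib_left algebra_simps)

lemma laplacian_uminus: "laplacian G (\<lambda>x. - f x) x = - laplacian G f x"
  using laplacian_mult[of "-1" f x] by simp

text \<open>Since \<open>wt\<close> is symmetric, exchanging the two summations makes both halves
  agree.\<close>

lemma deg_laplacian: "deg G (laplacian G f) = 0"
proof -
  let ?S = "\<Sum>x\<in>verts G. \<Sum>y\<in>verts G. wt G x y * of_int (f x)"
  have "deg G (laplacian G f) = ?S - (\<Sum>x\<in>verts G. \<Sum>y\<in>verts G. wt G x y * of_int (f y))"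
    by (simp add: deg_def laplacian_wt algebra_simps sum_subtractf)
  also have "(\<Sum>x\<in>verts G. \<Sum>y\<in>verts G. wt G x y * of_int (f y)) = ?S"
    by (subst sum.swap) (simp add: wt_commute)
  finally show ?thesis by simp
qed

text \<open>Chip firing: lowering a function by one on \<open>B\<close> makes \<open>B\<close> send
  each outside vertex its weight along the joining edges. Partial weight sums thus become values of
  Laplacians.\<close>

lemma laplacian_indicator:
  assumes "x \<notin> B"
  shows "laplacian G (\<lambda>y. if y \<in> B then - 1 else 0) x = (\<Sum>y\<in>{y\<in>verts G. y \<in> B}. wt G x y)"
proof -
  have "laplacian G (\<lambda>y. if y \<in> B then - 1 else 0) x
      = (\<Sum>y\<in>verts G. if y \<in> B then wt G x y else 0)"
    unfolding laplacian_wt using assms by (intro sum.cong) auto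
  then show ?thesis by (simp add: sum.If_cases[OF finite_verts] Int_def)
qed

lemma ex_neighbour:
  assumes x: "x \<in> verts G"
  shows "\<exists>y. {x, y} \<in> edges G"
proof -
  have "\<exists>z\<in>verts G. z \<noteq> x"
  proof (rule ccontr)
    assume "\<not> ?thesis"
    then have "verts G \<subseteq> {x}" by auto
    then have "card (verts G) \<le> 1" using card_mono[of "{x}" "verts G"] by simp
    then show False using card_verts by simp
  qed
  then obtain z where z: "z \<in> verts G" "z \<noteq> x" by blast
  then have "(x, z) \<in> {(u, v). {u, v} \<in> edges G}\<^sup>*" using connected x by blast
  then show ?thesis using z(2) by (cases rule: converse_rtranclE) auto
qed

lemma ex_crossing_edge:
  assumes "q \<in> S" "S \<subset> verts G"
  shows "\<exists>x y. x \<in> S \<and> y \<in> verts G - S \<and> {x, y} \<in> edges G"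
proof (rule ccontr)
  assume no: "\<not> ?thesis"
  obtain z where z: "z \<in> verts G" "z \<notin> S" using assms by blast
  have "(q, z) \<in> {(u, v). {u, v} \<in> edges G}\<^sup>*" using connected z assms by blast
  then have "z \<in> S"
  proof (induction rule: rtrancl_induct)
    case base
    show ?case using assms by simp
  next
    case (step u v)
    then show ?case using no edge_verts[of u v] by blast
  qed
  then show False using z by simp
qed

section \<open>Local units\<close>

text \<open>Laplacian values at \<open>x\<close> of functions vanishing there form a subgroup with a
  common denominator, so \<open>Least_abs_generates\<close> applies; subtracting the constant
  \<open>f x\<close> reduces a general \<open>f\<close> to this case.\<close>

lemma local_unit_props:
  assumes x: "x \<in> verts G"
  shows local_unit_pos: "0 < local_unit G x"
    and laplacian_multiple: "\<exists>k :: int. laplacian G f x = of_int k * local_unit G x"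
proof -
  let ?H = "{laplacian G f x | f. f x = 0}"
  have unit: "local_unit G x = (LEAST q. 0 < q \<and> (\<exists>a\<in>?H. q = \<bar>a\<bar>))"
    unfolding local_unit_def by (rule arg_cong[of _ _ Least], rule ext) (auto; blast)
  have "finite ((\<lambda>y. wt G x y) ` verts G)" using finite_verts by simp
  from common_denominator[OF this] obtain d :: nat
    where d: "0 < d" "\<And>y. y \<in> verts G \<Longrightarrow> of_nat d * wt G x y \<in> \<int>" by auto
  have dH: "of_nat d * a \<in> \<int>" if a: "a \<in> ?H" for a
  proof -
    obtain f where "a = laplacian G f x" using a by blast
    then have "of_nat d * a = (\<Sum>y\<in>verts G. (of_nat d * wt G x y) * of_int (f x - f y))"
      by (simp add: laplacian_wt sum_distrib_left algebra_simps)
    also have "\<dots> \<in> \<int>" by (intro Ints_sum Ints_mult d(2) Ints_of_int)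
    finally show ?thesis .
  qed
  have sub: "a - b \<in> ?H" if ab: "a \<in> ?H" "b \<in> ?H" for a b
  proof -
    obtain f g where "f x = 0" "g x = 0" "a = laplacian G f x" "b = laplacian G g x"
      using ab by blast
    then have "a - b = laplacian G (\<lambda>y. f y + - g y) x \<and> f x + - g x = 0"
      by (simp only: laplacian_add laplacian_uminus) simp
    then show ?thesis by blast
  qed
  \<comment> \<open>Lowering a single neighbour gives a nonzero element of the subgroup.\<close>
  obtain y where y: "{x, y} \<in> edges G" using ex_neighbour[OF x] by blast
  let ?f = "\<lambda>z. if z \<in> {y} then - 1 else 0 :: int"
  have yv: "y \<in> verts G" "x \<noteq> y" using edge_verts[OF y] by auto
  have "laplacian G ?f x = (\<Sum>z\<in>{z\<in>verts G. z \<in> {y}}. wt G x z)"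
    by (rule laplacian_indicator) (use yv in auto)
  moreover have "{z\<in>verts G. z \<in> {y}} = {y}" using yv by auto
  ultimately have h: "laplacian G ?f x = wt G x y" by simp
  have hH: "laplacian G ?f x \<in> ?H" using yv by (intro CollectI exI[of _ ?f]) auto
  have h0: "laplacian G ?f x \<noteq> 0" using wt_pos[OF y] h by simp
  note L = Least_abs_generates[OF sub hH h0 d(1) dH, folded unit]
  show "0 < local_unit G x" by (rule L(1))
  have "laplacian G f x = laplacian G (\<lambda>y. f y - f x) x"
    by (simp add: laplacian_def)
  then have "laplacian G f x \<in> ?H" by (intro CollectI exI[of _ "\<lambda>y. f y - f x"]) auto
  then show "\<exists>k :: int. laplacian G f x = of_int k * local_unit G x" by - (rule L(3))
qed

section \<open>The lattice of divisors\<close>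

lemma divisor_iff:
  "divisor G D \<longleftrightarrow> (\<forall>x\<in>verts G. \<exists>k :: int. D x = of_int k * local_unit G x) \<and>
     (\<forall>x. x \<notin> verts G \<longrightarrow> D x = 0)"
proof
  assume "divisor G D"
  then show "(\<forall>x\<in>verts G. \<exists>k :: int. D x = of_int k * local_unit G x) \<and>
      (\<forall>x. x \<notin> verts G \<longrightarrow> D x = 0)"
    by (auto simp: divisor_def divisor_of_def)
next
  assume *: "(\<forall>x\<in>verts G. \<exists>k :: int. D x = of_int k * local_unit G x) \<and>
      (\<forall>x. x \<notin> verts G \<longrightarrow> D x = 0)"
  then obtain l :: "'a \<Rightarrow> int" where "\<forall>x\<in>verts G. D x = of_int (l x) * local_unit G x" by metis
  then have "D = divisor_of G l" using * by (auto simp: divisor_of_def fun_eq_iff)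
  then show "divisor G D" by (auto simp: divisor_def)
qed

lemma effective_iff: "effective G D \<longleftrightarrow> divisor G D \<and> (\<forall>x. 0 \<le> D x)"
proof
  assume "effective G D"
  then show "divisor G D \<and> (\<forall>x. 0 \<le> D x)"
    using local_unit_pos by (auto simp: divisor_def effective_def divisor_of_def less_imp_le)
next
  assume *: "divisor G D \<and> (\<forall>x. 0 \<le> D x)"
  then obtain l where l: "D = divisor_of G l" by (auto simp: divisor_def)
  have "0 \<le> l x" if x: "x \<in> verts G" for x
  proof -
    have "0 \<le> of_int (l x) * local_unit G x" using * l x by (metis divisor_of_def)
    then show ?thesis using local_unit_pos[OF x] by (simp add: zero_le_mult_iff)
  qed
  then show "effective G D" using l by (auto simp: effective_def)
qed

lemma divisor_add:
  assumes "divisor G D" "divisor G E" shows "divisor G (\<lambda>x. D x + E x)"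
  unfolding divisor_iff
proof (intro conjI ballI allI impI)
  fix x assume "x \<in> verts G"
  then obtain k l :: int where "D x = of_int k * local_unit G x" "E x = of_int l * local_unit G x"
    using assms unfolding divisor_iff by blast
  then show "\<exists>k :: int. D x + E x = of_int k * local_unit G x"
    by (intro exI[of _ "k + l"]) (simp add: algebra_simps)
qed (use assms in \<open>simp add: divisor_iff\<close>)

lemma divisor_diff:
  assumes "divisor G D" "divisor G E" shows "divisor G (\<lambda>x. D x - E x)"
  unfolding divisor_iff
proof (intro conjI ballI allI impI)
  fix x assume "x \<in> verts G"
  then obtain k l :: int where "D x = of_int k * local_unit G x" "E x = of_int l * local_unit G x"
    using assms unfolding divisor_iff by blast
  then show "\<exists>k :: int. D x - E x = of_int k * local_unit G x"
    by (intro exI[of _ "k - l"]) (simp add: algebra_simps)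
qed (use assms in \<open>simp add: divisor_iff\<close>)

lemma divisor_laplacian: "divisor G (laplacian G f)"
  by (simp add: divisor_iff laplacian_multiple laplacian_outside)

text \<open>Divisor values at \<open>x\<close> are integer multiples of the local unit, so a strict
  inequality leaves a gap of at least one unit.\<close>

lemma divisor_less_imp_le_diff:
  assumes less: "D x < E x" and D: "divisor G D" and E: "divisor G E" and x: "x \<in> verts G"
  shows "D x \<le> E x - local_unit G x"
proof -
  from assms obtain k l :: int where kl: "D x = of_int k * local_unit G x" "E x = of_int l * local_unit G x"
    unfolding divisor_iff by blast
  then have "k < l" using less local_unit_pos[OF x] by simp
  then have "k + 1 \<le> l" by simp
  then have "of_int (k + 1) * local_unit G x \<le> of_int l * local_unit G x"
    using local_unit_pos[OF x] by (intro mult_right_mono) (simp_all only: of_int_le_iff less_imp_le)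
  then show ?thesis using kl by (simp add: algebra_simps)
qed

text \<open>At each vertex the partial sum is a Laplacian value, of an indicator that may depend on
  the vertex.\<close>

lemma divisor_sum_wt:
  "divisor G (\<lambda>x. if x \<in> verts G then \<Sum>y\<in>{y\<in>verts G. R x y}. wt G x y else 0)"
  unfolding divisor_iff
proof (intro conjI ballI allI impI)
  fix x assume x: "x \<in> verts G"
  \<comment> \<open>The indicator formula asks for \<open>x\<close> outside the set; removing it is
    harmless as \<open>wt G x x = 0\<close>.\<close>
  let ?B = "{y. R x y} - {x}"
  have "(\<Sum>y\<in>{y\<in>verts G. R x y}. wt G x y) = (\<Sum>y\<in>{y\<in>verts G. y \<in> ?B}. wt G x y)"
    using finite_verts by (intro sum.mono_neutral_right) auto
  also have "\<dots> = laplacian G (\<lambda>y. if y \<in> ?B then - 1 else 0) x"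
    by (rule laplacian_indicator[symmetric]) simp
  finally show "\<exists>k :: int. (if x \<in> verts G then \<Sum>y\<in>{y\<in>verts G. R x y}. wt G x y else 0)
      = of_int k * local_unit G x"
    using laplacian_multiple[OF x] x by simp
qed simp

lemma divisor_local_unit: "divisor G (\<lambda>x. if x \<in> verts G then local_unit G x else 0)"
  unfolding divisor_iff by (auto intro: exI[of _ 1])

section \<open>Order divisors and the canonical divisor\<close>

lemma divisor_order_divisor: "divisor G (order_divisor G p)"
proof -
  have "order_divisor G p = (\<lambda>x. (if x \<in> verts G then \<Sum>y\<in>{y\<in>verts G. p y < p x}. wt G x y else 0)
      - (if x \<in> verts G then local_unit G x else 0))"
    by (auto simp: order_divisor_def fun_eq_iff)
  then show ?thesis
    using divisor_diff[OF divisor_sum_wt[of "\<lambda>x y. p y < p x"] divisor_local_unit] by simp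
qed

text \<open>Every other vertex is either earlier or later than \<open>x\<close>, so the two partial
  sums add up to the total weight at \<open>x\<close>.\<close>

lemma order_divisor_reverse:
  assumes "inj_on p (verts G)"
  shows "canonical G x - order_divisor G p x = order_divisor G (\<lambda>x. - p x) x"
proof (cases "x \<in> verts G")
  case True
  have "(\<Sum>y\<in>nbrs G x. weight G {x, y}) = (\<Sum>y\<in>verts G. wt G x y)"
    using sum_nbrs[of x "\<lambda>_. 1"] by simp
  also have "\<dots> = (\<Sum>y\<in>verts G - {x}. wt G x y)"
    using finite_verts by (intro sum.mono_neutral_right) auto
  also have "verts G - {x} = {y\<in>verts G. p y < p x} \<union> {y\<in>verts G. p x < p y}"
    using assms True by (auto simp: inj_on_def) force
  also have "(\<Sum>y\<in>\<dots>. wt G x y)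
      = (\<Sum>y\<in>{y\<in>verts G. p y < p x}. wt G x y) + (\<Sum>y\<in>{y\<in>verts G. p x < p y}. wt G x y)"
    using finite_verts by (intro sum.union_disjoint) auto
  finally show ?thesis using True by (simp add: canonical_def order_divisor_def)
qed (simp add: canonical_def order_divisor_def)

lemma deg_add: "deg G (\<lambda>x. D x + E x) = deg G D + deg G E"
  by (simp add: deg_def sum.distrib)

lemma deg_diff: "deg G (\<lambda>x. D x - E x) = deg G D - deg G E"
  by (simp add: deg_def sum_subtractf)

text \<open>An injective labelling orients each edge exactly once, so the weights to earlier
  vertices add up to the total edge weight.\<close>

lemma deg_order_divisor:
  assumes "inj_on p (verts G)"
  shows "deg G (order_divisor G p) = - euler G"
proof -
  let ?A = "Sigma (verts G) (\<lambda>x. {y\<in>verts G. p y < p x})"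
  let ?B = "{(x, y). {x, y} \<in> edges G \<and> p y < p x}"
  have sub: "?B \<subseteq> ?A" using edge_verts by auto
  have fin: "finite ?A" using finite_verts by auto
  have "(\<Sum>x\<in>verts G. \<Sum>y\<in>{y\<in>verts G. p y < p x}. wt G x y) = (\<Sum>(x, y)\<in>?A. wt G x y)"
    using finite_verts by (intro sum.Sigma) auto
  also have "\<dots> = (\<Sum>(x, y)\<in>?B. weight G {x, y})"
    by (rule sum.mono_neutral_cong_right[OF fin sub]) (auto simp: wt_def split: if_splits)
  also have "\<dots> = (\<Sum>e\<in>edges G. weight G e)"
  proof (rule sum.reindex_cong[symmetric])
    show "inj_on (\<lambda>(x, y). {x, y}) ?B" by (auto simp: inj_on_def doubleton_eq_iff)
    show "edges G = (\<lambda>(x, y). {x, y}) ` ?B"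
    proof (intro equalityI subsetI)
      fix e assume e: "e \<in> edges G"
      then obtain x y where xy: "x \<in> verts G" "y \<in> verts G" "x \<noteq> y" "e = {x, y}" by (rule edgeE)
      then have "p x \<noteq> p y" using assms by (auto simp: inj_on_def)
      then consider "p y < p x" | "p x < p y" by linarith
      then show "e \<in> (\<lambda>(x, y). {x, y}) ` ?B"
      proof cases
        case 1
        then show ?thesis using e xy by (intro image_eqI[of _ _ "(x, y)"]) auto
      next
        case 2
        then show ?thesis using e xy
          by (intro image_eqI[of _ _ "(y, x)"]) (auto simp: insert_commute)
      qed
    qed auto
  qed auto
  finally show ?thesis by (simp add: deg_def order_divisor_def euler_def sum_subtractf)
qed

lemma ex_injective_labelling: "\<exists>p :: 'a \<Rightarrow> int. inj_on p (verts G)"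
proof -
  obtain p :: "'a \<Rightarrow> nat" where "inj_on p (verts G)"
    using finite_imp_inj_to_nat_seg[OF finite_verts] by blast
  then have "inj_on (\<lambda>x. int (p x)) (verts G)" by (auto simp: inj_on_def)
  then show ?thesis by blast
qed

text \<open>The canonical divisor is the sum of the divisors of an order and of its reverse; this
  decomposition also yields its degree.\<close>

lemma divisor_canonical: "divisor G (canonical G)"
proof -
  obtain p :: "'a \<Rightarrow> int" where p: "inj_on p (verts G)" using ex_injective_labelling by blast
  have "canonical G = (\<lambda>x. order_divisor G p x + order_divisor G (\<lambda>x. - p x) x)"
    using order_divisor_reverse[OF p] by (auto simp: fun_eq_iff algebra_simps)
  then show ?thesis using divisor_add[OF divisor_order_divisor divisor_order_divisor] by simp
qed

lemma deg_canonical: "deg G (canonical G) = - 2 * euler G"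
proof -
  obtain p :: "'a \<Rightarrow> int" where p: "inj_on p (verts G)" using ex_injective_labelling by blast
  then have p': "inj_on (\<lambda>x. - p x) (verts G)" by (auto simp: inj_on_def)
  have "canonical G = (\<lambda>x. order_divisor G p x + order_divisor G (\<lambda>x. - p x) x)"
    using order_divisor_reverse[OF p] by (auto simp: fun_eq_iff algebra_simps)
  then have "deg G (canonical G) = deg G (order_divisor G p) + deg G (order_divisor G (\<lambda>x. - p x))"
    by (metis deg_add)
  then show ?thesis using deg_order_divisor[OF p] deg_order_divisor[OF p'] by simp
qed

section \<open>Order divisors have empty linear systems\<close>

lemma linear_system_empty_iff:
  "linear_system G D = {} \<longleftrightarrow> (\<forall>f. \<not> effective G (\<lambda>x. D x + laplacian G f x))"
  by (auto simp: linear_system_def lin_equiv_def)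

lemma verts_nonempty: "verts G \<noteq> {}"
  using card_verts by auto

text \<open>Adding the Laplacian of \<open>f\<close> pushes the value at the first vertex among the minimisers of \<open>f\<close>
  below zero: all earlier neighbours have larger \<open>f\<close>, and only later ones can be minimisers.\<close>

lemma linear_system_order_divisor:
  "linear_system G (order_divisor G p) = {}"
  unfolding linear_system_empty_iff
proof (intro allI notI)
  fix f
  assume eff: "effective G (\<lambda>x. order_divisor G p x + laplacian G f x)"
  define A where "A = {x\<in>verts G. \<forall>y\<in>verts G. f x \<le> f y}"
  have "finite A" using finite_verts by (simp add: A_def)
  moreover have "A \<noteq> {}"
  proof -
    obtain x where "is_arg_min f (\<lambda>x. x \<in> verts G) x"
      using ex_is_arg_min_if_finite[OF finite_verts verts_nonempty] by blast
    then have "x \<in> A" by (auto simp: A_def is_arg_min_linorder)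
    then show ?thesis by blast
  qed
  ultimately obtain x where "is_arg_min p (\<lambda>x. x \<in> A) x"
    using ex_is_arg_min_if_finite by blast
  then have x: "x \<in> A" "\<And>y. y \<in> A \<Longrightarrow> p x \<le> p y" by (auto simp: is_arg_min_linorder)
  then have xv: "x \<in> verts G" by (simp add: A_def)
  have "laplacian G f x \<le> (\<Sum>y\<in>verts G. if p y < p x then - wt G x y else 0)"
    unfolding laplacian_wt
  proof (rule sum_mono)
    fix y assume y: "y \<in> verts G"
    have fxy: "f x \<le> f y" using x(1) y by (simp add: A_def)
    show "wt G x y * of_int (f x - f y) \<le> (if p y < p x then - wt G x y else 0)"
    proof (cases "p y < p x")
      case True
      then have "y \<notin> A" using x(2) by force
      then obtain z where "z \<in> verts G" "f z < f y" using y by (auto simp: A_def not_le)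
      then have "f x < f y" using x(1) by (force simp: A_def)
      \<comment> \<open>Integer values make the gap at least one, so each earlier \<open>y\<close>
        contributes at most minus its weight.\<close>
      then have "f x - f y \<le> - 1" by simp
      then have "of_int (f x - f y) \<le> (of_int (- 1) :: rat)" by (simp only: of_int_le_iff)
      then have "wt G x y * of_int (f x - f y) \<le> wt G x y * of_int (- 1)"
        by (rule mult_left_mono) (rule wt_nonneg)
      then show ?thesis using True by simp
    next
      case False
      then show ?thesis using fxy wt_nonneg[of x y] by (simp add: mult_le_0_iff)
    qed
  qed
  also have "\<dots> = - (\<Sum>y\<in>{y\<in>verts G. p y < p x}. wt G x y)"
    by (simp add: sum.If_cases[OF finite_verts] Int_def sum_negf)
  \<comment> \<open>The bound cancels the weight to earlier vertices and leaves at most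
    \<open>- local_unit G x\<close>.\<close>
  finally have "order_divisor G p x + laplacian G f x < 0"
    using xv local_unit_pos[OF xv] by (simp add: order_divisor_def)
  then show False using eff by (auto simp: effective_iff not_le[symmetric])
qed

section \<open>Superharmonic functions and reduced representatives\<close>

text \<open>Take a largest set \<open>S\<close> on which, apart from \<open>q\<close>, positivity
  holds, with nonnegativity elsewhere. If \<open>S\<close> is proper, an edge leads from it to some
  \<open>y\<close>; adding the firing of \<open>S\<close> to a large multiple of \<open>g\<close>
  gains positivity at \<open>y\<close> and keeps it on \<open>S\<close>.\<close>

lemma ex_superharmonic:
  assumes q: "q \<in> verts G"
  shows "\<exists>g. g q = 0 \<and> (\<forall>x\<in>verts G - {q}. 0 < laplacian G g x)"
proof -
  define P where "P S \<longleftrightarrow> q \<in> S \<and> S \<subseteq> verts G \<and>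
    (\<exists>g. g q = 0 \<and> (\<forall>x\<in>S - {q}. 0 < laplacian G g x) \<and>
      (\<forall>x\<in>verts G - S. 0 \<le> laplacian G g x))" for S
  have "P {q}" unfolding P_def using q by (auto intro!: exI[of _ "\<lambda>_. 0"] simp: laplacian_def)
  moreover have "\<forall>S. P S \<longrightarrow> card S < Suc (card (verts G))"
    using finite_verts by (auto simp: P_def card_mono less_Suc_eq_le)
  ultimately obtain S where S: "P S" "\<And>T. P T \<Longrightarrow> card T \<le> card S"
    using ex_has_greatest_nat[of P "{q}" card "Suc (card (verts G))"] by blast
  have fS: "finite S" using S(1) finite_verts finite_subset by (auto simp: P_def)
  obtain g where g: "g q = 0" "\<forall>x\<in>S - {q}. 0 < laplacian G g x"
      "\<forall>x\<in>verts G - S. 0 \<le> laplacian G g x"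
    using S(1) by (auto simp: P_def)
  have "S = verts G"
  proof (rule ccontr)
    assume "S \<noteq> verts G"
    then have "S \<subset> verts G" using S(1) by (auto simp: P_def)
    then obtain x y where xy: "x \<in> S" "y \<in> verts G - S" "{x, y} \<in> edges G"
      using ex_crossing_edge[of q S] S(1) by (auto simp: P_def)
    \<comment> \<open>The firing function of \<open>S\<close>, raised by a constant so that it
      vanishes on \<open>S\<close> and in particular at \<open>q\<close>.\<close>
    let ?h = "\<lambda>x. (if x \<in> S then - 1 else 0) + 1 :: int"
    obtain n :: nat where n: "\<forall>x\<in>S - {q}. - laplacian G ?h x < of_nat n * laplacian G g x"
      using ex_multiple_dominating[of "S - {q}" "laplacian G g" "\<lambda>x. - laplacian G ?h x"] fS g(2)
      by auto
    define g' where "g' = (\<lambda>x. int n * g x + ?h x)"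
    have lap: "laplacian G g' z = of_nat n * laplacian G g z + laplacian G ?h z" for z
      unfolding g'_def by (simp only: laplacian_add laplacian_mult of_int_of_nat_eq)
    have h: "laplacian G ?h z = (\<Sum>y\<in>{y\<in>verts G. y \<in> S}. wt G z y)" if "z \<notin> S" for z
      using laplacian_indicator[OF that] by (simp add: laplacian_def)
    have outside: "0 \<le> laplacian G g' z" if "z \<in> verts G - S" for z
      using that g(3) by (simp add: lap h sum_nonneg wt_nonneg)
    have "wt G y x \<le> laplacian G ?h y"
      using xy S(1) finite_verts by (subst h) (auto simp: P_def wt_nonneg intro!: member_le_sum)
    moreover have "0 < wt G y x" using wt_pos[OF xy(3)] by (simp add: wt_commute)
    ultimately have "0 < laplacian G g' y"
      using g(3) xy(2) by (simp add: lap add_nonneg_pos)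
    moreover have "0 < laplacian G g' z" if "z \<in> S - {q}" for z
      using n that by (force simp: lap)
    moreover have "g' q = 0" using g(1) S(1) by (simp add: g'_def P_def)
    ultimately have "g' q = 0 \<and> (\<forall>z\<in>insert y S - {q}. 0 < laplacian G g' z) \<and>
        (\<forall>z\<in>verts G - insert y S. 0 \<le> laplacian G g' z)"
      using outside by blast
    then have "P (insert y S)" unfolding P_def using S(1) xy(2) by (auto simp: P_def)
    then have "card (insert y S) \<le> card S" by (rule S(2))
    then show False using fS xy(2) by simp
  qed
  then show ?thesis using g by blast
qed

text \<open>The Laplacian is at most zero at a global minimiser, so only \<open>q\<close> can be
  one.\<close>

lemma minimum_principle:
  assumes q: "q \<in> verts G" and pos: "\<forall>x\<in>verts G - {q}. 0 < laplacian G h x" and x: "x \<in> verts G"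
  shows "h q \<le> h x"
proof -
  obtain z where "is_arg_min h (\<lambda>x. x \<in> verts G) z"
    using ex_is_arg_min_if_finite[OF finite_verts verts_nonempty] by blast
  then have z: "z \<in> verts G" "\<And>y. y \<in> verts G \<Longrightarrow> h z \<le> h y" by (auto simp: is_arg_min_linorder)
  have "laplacian G h z \<le> 0" unfolding laplacian_wt
    using z(2) by (intro sum_nonpos) (simp add: mult_nonneg_nonpos wt_nonneg)
  then have "z = q" using pos z(1) by force
  then show ?thesis using z(2)[OF x] by simp
qed

text \<open>A \<open>q\<close>-reduced representative comes from a function with minimal sum among those that
  vanish at \<open>q\<close> and make the divisor nonnegative off \<open>q\<close>: lowering it on a set
  that can be fired would decrease the sum further.\<close>

lemma ex_reduced:
  assumes q: "q \<in> verts G"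
  shows "\<exists>f. (\<forall>x\<in>verts G - {q}. 0 \<le> D x + laplacian G f x) \<and>
    (\<forall>B. B \<subseteq> verts G - {q} \<longrightarrow> B \<noteq> {} \<longrightarrow>
      (\<exists>x\<in>B. D x + laplacian G f x < (\<Sum>y\<in>{y\<in>verts G. y \<notin> B}. wt G x y)))"
proof -
  obtain g where g: "g q = 0" "\<forall>x\<in>verts G - {q}. 0 < laplacian G g x"
    using ex_superharmonic[OF q] by blast
  \<comment> \<open>\<open>n * g\<close> is a first candidate for \<open>f\<close>, and its negative
    bounds all candidates from below.\<close>
  obtain n :: nat where n: "\<forall>x\<in>verts G - {q}. \<bar>D x\<bar> < of_nat n * laplacian G g x"
    using ex_multiple_dominating[of "verts G - {q}" "laplacian G g" "\<lambda>x. \<bar>D x\<bar>"] finite_verts g(2)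
    by auto
  have lap_ng: "laplacian G (\<lambda>x. int n * g x) x = of_nat n * laplacian G g x" for x
    by (simp add: laplacian_mult)
  define F where "F f \<longleftrightarrow> f q = 0 \<and> (\<forall>x\<in>verts G - {q}. 0 \<le> D x + laplacian G f x)" for f
  have F0: "F (\<lambda>x. int n * g x)"
    using n g(1) by (force simp: F_def lap_ng)
  \<comment> \<open>Off \<open>q\<close> the Laplacian of \<open>f\<close> is at least
    \<open>- D\<close> and that of \<open>n * g\<close> exceeds \<open>D\<close>, so the minimum
    principle applies to the sum of the two functions, which vanishes at \<open>q\<close>.\<close>
  have lower: "0 \<le> f x + int n * g x" if f: "F f" and x: "x \<in> verts G" for f x
  proof -
    let ?h = "\<lambda>x. f x + int n * g x"
    have "0 < laplacian G ?h x" if "x \<in> verts G - {q}" for x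
      using n f that by (force simp: laplacian_add lap_ng F_def)
    then have "?h q \<le> ?h x" using minimum_principle[OF q _ x, of ?h] by blast
    then show ?thesis using f g(1) by (simp add: F_def)
  qed
  \<comment> \<open>The shift by \<open>n * g\<close> makes the sum nonnegative for every candidate,
    so \<open>nat\<close> loses nothing.\<close>
  let ?m = "\<lambda>f. nat (\<Sum>x\<in>verts G. f x + int n * g x)"
  obtain f where f: "F f" "\<And>f'. F f' \<Longrightarrow> ?m f \<le> ?m f'"
    using ex_has_least_nat[of F, OF F0, of ?m] by blast
  have "\<exists>x\<in>B. D x + laplacian G f x < (\<Sum>y\<in>{y\<in>verts G. y \<notin> B}. wt G x y)"
    if B: "B \<subseteq> verts G - {q}" "B \<noteq> {}" for B
  proof (rule ccontr)
    assume *: "\<not> ?thesis"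
    let ?b = "\<lambda>x. if x \<in> B then - 1 else 0 :: int"
    let ?c = "\<lambda>x. if x \<in> - B then - 1 else 0 :: int"
    define f' where "f' = (\<lambda>x. f x + ?b x)"
    have lap: "laplacian G f' x = laplacian G f x + laplacian G ?b x" for x
      unfolding f'_def by (rule laplacian_add)
    have "0 \<le> D x + laplacian G f' x" if x: "x \<in> verts G - {q}" for x
    proof (cases "x \<in> B")
      case True
      \<comment> \<open>Up to a constant, lowering on \<open>B\<close> is raising on its complement,
        so a vertex of \<open>B\<close> loses its weight to the vertices outside \<open>B\<close>.
        By the negated claim it can afford this.\<close>
      have "?b = (\<lambda>x. - ?c x + - 1)" by auto
      then have "laplacian G ?b x = laplacian G (\<lambda>x. - ?c x + - 1) x" by simp
      also have "\<dots> = laplacian G (\<lambda>x. - ?c x) x" by (simp only: laplacian_def) simp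
      also have "\<dots> = - (\<Sum>y\<in>{y\<in>verts G. y \<in> - B}. wt G x y)"
        unfolding laplacian_uminus using True by (subst laplacian_indicator) auto
      finally show ?thesis using * True by (force simp: lap not_less)
    next
      case False
      have "0 \<le> laplacian G ?b x" using laplacian_indicator[OF False] by (simp add: sum_nonneg wt_nonneg)
      then show ?thesis using f(1) x by (force simp: lap F_def)
    qed
    then have F': "F f'" using f(1) B by (auto simp: F_def f'_def)
    obtain b where b: "b \<in> B" using B by blast
    have "(\<Sum>x\<in>verts G. f' x + int n * g x) < (\<Sum>x\<in>verts G. f x + int n * g x)"
      using b B finite_verts by (intro sum_strict_mono_ex1) (auto simp: f'_def)
    moreover have "0 \<le> (\<Sum>x\<in>verts G. f' x + int n * g x)" by (intro sum_nonneg lower[OF F'])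
    ultimately have "?m f' < ?m f" by linarith
    then show False using f(2)[OF F'] by linarith
  qed
  then show ?thesis using f(1) by (auto simp: F_def)
qed

text \<open>Dhar's burning algorithm on a reduced representative produces the order.\<close>

lemma order_divisor_minus_effective:
  assumes D: "divisor G D" and empty: "linear_system G D = {}"
  shows "\<exists>p f. inj_on p (verts G) \<and> effective G (\<lambda>x. order_divisor G p x - D x + laplacian G f x)"
proof -
  obtain q where q: "q \<in> verts G" using verts_nonempty by blast
  let ?V = "verts G - {q}"
  obtain f where f: "\<forall>x\<in>?V. 0 \<le> D x + laplacian G f x"
    "\<And>B. B \<subseteq> ?V \<Longrightarrow> B \<noteq> {} \<Longrightarrow>
      \<exists>x\<in>B. D x + laplacian G f x < (\<Sum>y\<in>{y\<in>verts G. y \<notin> B}. wt G x y)"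
    using ex_reduced[OF q, of D] by blast
  define R where "R = (\<lambda>x. D x + laplacian G f x)"
  have Rdiv: "divisor G R" unfolding R_def by (rule divisor_add[OF D divisor_laplacian])
  obtain p0 :: "'a \<Rightarrow> nat" where p0: "inj_on p0 ?V"
      "\<And>x. x \<in> ?V \<Longrightarrow> R x < (\<Sum>y\<in>{y\<in>verts G. y \<notin> ?V \<or> p0 y < p0 x}. wt G x y)"
    using burning_order[where A = ?V and d = R and V = "verts G" and w = "wt G"] f(2) finite_verts by (auto simp: R_def)
  define p where "p = (\<lambda>x. if x = q then 0 else 1 + int (p0 x))"
  have inj: "inj_on p (verts G)" using p0(1) by (auto simp: p_def inj_on_def)
  have le: "R x \<le> order_divisor G p x" if x: "x \<in> ?V" for x
  proof -
    let ?S = "\<lambda>x. if x \<in> verts G then \<Sum>y\<in>{y\<in>verts G. p y < p x}. wt G x y else 0"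
    have "{y\<in>verts G. y \<notin> ?V \<or> p0 y < p0 x} = {y\<in>verts G. p y < p x}"
      using x by (auto simp: p_def)
    then have "R x < ?S x" using p0(2)[OF x] x by simp
    \<comment> \<open>Strictness between divisor values is worth a whole local unit, the one that
      \<open>order_divisor\<close> subtracts.\<close>
    then show ?thesis
      using divisor_less_imp_le_diff[OF _ Rdiv divisor_sum_wt[of "\<lambda>x y. p y < p x"], of x] x
      by (simp add: order_divisor_def)
  qed
  \<comment> \<open>\<open>R\<close> is nonnegative off \<open>q\<close>, so emptiness of the linear
    system must show at \<open>q\<close>. A negative value there is at most
    \<open>- local_unit G q\<close>, the value of \<open>order_divisor\<close> at the first
    vertex.\<close>
  have "\<not> (\<forall>x. 0 \<le> R x)"
    using empty Rdiv unfolding linear_system_empty_iff effective_iff R_def by blast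
  then obtain z where z: "R z < 0" by (auto simp: not_le)
  then have "z = q" using f(1) Rdiv by (force simp: R_def divisor_iff)
  then have "R q < (\<lambda>_. 0) q" using z by simp
  then have "R q \<le> - local_unit G q"
    using divisor_less_imp_le_diff[OF _ Rdiv _ q, of "\<lambda>_. 0"] by (simp add: divisor_iff)
  moreover have first: "{y\<in>verts G. p y < p q} = {}" by (auto simp: p_def)
  have "order_divisor G p q = - local_unit G q"
    by (simp only: order_divisor_def first q if_True sum.empty diff_0)
  ultimately have "\<forall>x. R x \<le> order_divisor G p x"
    using le Rdiv by (metis DiffI divisor_iff divisor_order_divisor order_refl singletonD)
  then have "effective G (\<lambda>x. order_divisor G p x - R x)"
    using divisor_diff[OF divisor_order_divisor Rdiv] by (simp add: effective_iff)
  moreover have "(\<lambda>x. order_divisor G p x - R x)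
      = (\<lambda>x. order_divisor G p x - D x + laplacian G (\<lambda>x. - f x) x)"
    by (simp add: R_def laplacian_uminus fun_eq_iff)
  ultimately show ?thesis using inj by metis
qed

section \<open>Degrees and the global unit\<close>

text \<open>Degrees of divisors form a subgroup of the rationals with a common denominator, so the
  argument for local units applies again.\<close>

lemma global_unit_pos: "0 < global_unit G"
  and deg_multiple: "divisor G D \<Longrightarrow> \<exists>k :: int. deg G D = of_int k * global_unit G"
proof -
  let ?H = "{\<Sum>x\<in>verts G. of_int (l x) * local_unit G x | l :: 'a \<Rightarrow> int. True}"
  have unit: "global_unit G = (LEAST q. 0 < q \<and> (\<exists>a\<in>?H. q = \<bar>a\<bar>))"
    unfolding global_unit_def by (rule arg_cong[of _ _ Least]) auto
  have "finite (local_unit G ` verts G)" using finite_verts by simp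
  from common_denominator[OF this] obtain d :: nat
    where d: "0 < d" "\<And>y. y \<in> verts G \<Longrightarrow> of_nat d * local_unit G y \<in> \<int>" by auto
  have dH: "of_nat d * a \<in> \<int>" if a: "a \<in> ?H" for a
  proof -
    obtain l :: "'a \<Rightarrow> int" where "a = (\<Sum>x\<in>verts G. of_int (l x) * local_unit G x)"
      using a by blast
    then have "of_nat d * a = (\<Sum>y\<in>verts G. (of_nat d * local_unit G y) * of_int (l y))"
      by (simp add: sum_distrib_left algebra_simps)
    also have "\<dots> \<in> \<int>" by (intro Ints_sum Ints_mult d(2) Ints_of_int)
    finally show ?thesis .
  qed
  have sub: "a - b \<in> ?H" if ab: "a \<in> ?H" "b \<in> ?H" for a b
  proof -
    obtain l m :: "'a \<Rightarrow> int" where "a = (\<Sum>x\<in>verts G. of_int (l x) * local_unit G x)"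
      "b = (\<Sum>x\<in>verts G. of_int (m x) * local_unit G x)" using ab by blast
    then have "a - b = (\<Sum>x\<in>verts G. of_int (l x - m x) * local_unit G x)"
      by (simp add: sum_subtractf algebra_simps)
    then show ?thesis by (intro CollectI exI[of _ "\<lambda>x. l x - m x"]) simp
  qed
  let ?h = "\<Sum>x\<in>verts G. of_int 1 * local_unit G x"
  have hH: "?h \<in> ?H" by (intro CollectI exI[of _ "\<lambda>_. 1"]) simp
  have "0 < ?h" using finite_verts verts_nonempty local_unit_pos by (simp add: sum_pos)
  then have h0: "?h \<noteq> 0" by simp
  note L = Least_abs_generates[OF sub hH h0 d(1) dH, folded unit]
  show "0 < global_unit G" by (rule L(1))
  assume "divisor G D"
  then obtain l where "D = divisor_of G l" by (auto simp: divisor_def)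
  then have "deg G D \<in> ?H" by (auto simp: deg_def divisor_of_def)
  then show "\<exists>k :: int. deg G D = of_int k * global_unit G" by - (rule L(3))
qed

lemma deg_effective:
  assumes "effective G E"
  obtains k :: nat where "deg G E = of_nat k * global_unit G"
proof -
  obtain k :: int where k: "deg G E = of_int k * global_unit G"
    using deg_multiple assms by (auto simp: effective_iff)
  have "0 \<le> deg G E" using assms by (auto simp: deg_def effective_iff intro: sum_nonneg)
  then have "0 \<le> k" using k global_unit_pos by (simp add: zero_le_mult_iff)
  then have "deg G E = of_nat (nat k) * global_unit G" using k by simp
  then show ?thesis by (rule that)
qed

lemma effective_deg_0:
  assumes "effective G E" "deg G E = 0"
  shows "E = (\<lambda>_. 0)"
proof
  fix x
  have "\<forall>x\<in>verts G. E x = 0"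
    using assms finite_verts by (subst (asm) deg_def) (auto simp: effective_iff sum_nonneg_eq_0_iff)
  then show "E x = 0" using assms(1) by (auto simp: effective_iff divisor_iff)
qed

section \<open>Rank through minimal obstructions\<close>

text \<open>Minimality ranges over effective divisors of every degree, in accordance with a rank
  that tests all degrees up to \<open>k\<close>.\<close>

definition minimal_obstruction :: "('a \<Rightarrow> rat) \<Rightarrow> ('a \<Rightarrow> rat) \<Rightarrow> bool" where
  "minimal_obstruction D E \<longleftrightarrow> effective G E \<and> linear_system G (\<lambda>x. D x - E x) = {} \<and>
     (\<forall>E'. effective G E' \<longrightarrow> linear_system G (\<lambda>x. D x - E' x) = {} \<longrightarrow> deg G E \<le> deg G E')"

text \<open>Subtracting a divisor of degree larger than that of \<open>D\<close> leaves a negative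
  degree, which adding a Laplacian cannot repair. Effective degrees are natural multiples of
  \<open>global_unit G\<close>, so a least one is attained.\<close>

lemma ex_minimal_obstruction: "\<exists>E. minimal_obstruction D E"
proof -
  let ?P = "\<lambda>k. \<exists>E. effective G E \<and> linear_system G (\<lambda>x. D x - E x) = {} \<and>
    deg G E = of_nat k * global_unit G"
  let ?s = "\<lambda>x. if x \<in> verts G then local_unit G x else 0"
  have spos: "0 < deg G ?s" using finite_verts verts_nonempty local_unit_pos
    by (auto simp: deg_def intro!: sum_pos)
  obtain n :: nat where n: "deg G D < of_nat n * deg G ?s" using ex_less_of_nat_mult[OF spos] by blast
  define E where "E = (\<lambda>x. of_nat n * ?s x)"
  have E: "effective G E"
    unfolding effective_iff divisor_iff E_def using local_unit_pos
    by (auto simp: less_imp_le intro!: exI[of _ "int n"])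
  have degE: "deg G E = of_nat n * deg G ?s" by (simp add: E_def deg_def sum_distrib_left)
  have "linear_system G (\<lambda>x. D x - E x) = {}"
    unfolding linear_system_empty_iff
  proof (intro allI notI)
    fix f assume "effective G (\<lambda>x. D x - E x + laplacian G f x)"
    then have "0 \<le> deg G (\<lambda>x. D x - E x + laplacian G f x)"
      unfolding effective_iff deg_def by (auto intro: sum_nonneg)
    then show False using n degE by (simp add: deg_add deg_diff deg_laplacian)
  qed
  then have "\<exists>k. ?P k" using E deg_effective[OF E] by metis
  then have least: "?P (LEAST k. ?P k)" by (rule LeastI_ex)
  then obtain E0 where E0: "effective G E0" "linear_system G (\<lambda>x. D x - E0 x) = {}"
    "deg G E0 = of_nat (LEAST k. ?P k) * global_unit G" by blast
  have "deg G E0 \<le> deg G E'" if E': "effective G E'" "linear_system G (\<lambda>x. D x - E' x) = {}" for E'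
  proof -
    obtain k where k: "deg G E' = of_nat k * global_unit G" using deg_effective[OF E'(1)] by blast
    then have "(LEAST k. ?P k) \<le> k" using E' by (intro Least_le) blast
    then show ?thesis using E0(3) k global_unit_pos by simp
  qed
  then show ?thesis using E0 by (auto simp: minimal_obstruction_def)
qed

text \<open>If the least obstructing degree is \<open>k\<close> units, all smaller degrees pass the
  test and degree \<open>k\<close> fails, so the rank is \<open>k - 1\<close> units. For
  \<open>k = 0\<close> the obstruction is the zero divisor, and the default
  \<open>- global_unit G\<close> fits the same formula.\<close>

lemma rank_eq_minimal_obstruction:
  assumes "minimal_obstruction D E"
  shows "rank G D = deg G E - global_unit G"
proof -
  note u = global_unit_pos
  have E: "effective G E" "linear_system G (\<lambda>x. D x - E x) = {}"
    and min: "\<And>E'. effective G E' \<Longrightarrow> deg G E' < deg G E \<Longrightarrow> linear_system G (\<lambda>x. D x - E' x) \<noteq> {}"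
    using assms by (auto simp: minimal_obstruction_def not_le[symmetric])
  obtain k where k: "deg G E = of_nat k * global_unit G" using deg_effective[OF E(1)] by blast
  show ?thesis
  proof (cases k)
    case 0
    then have E0: "E = (\<lambda>_. 0)" using k effective_deg_0[OF E(1)] by simp
    have "E' = E" if "E' \<in> eff_divisors G 0" for E'
      using that effective_deg_0[of E'] by (simp add: eff_divisors_def E0)
    then have "subtractable G D 0 = {}" using E(2) by (auto simp: subtractable_def)
    then show ?thesis using k 0 by (simp add: rank_def)
  next
    case (Suc m)
    have below: "subtractable G D j = eff_divisors G j" if "j \<le> m" for j
    proof -
      have "of_nat j * global_unit G < deg G E" using k Suc that u by simp
      then show ?thesis using min by (auto simp: subtractable_def eff_divisors_def)
    qed
    \<comment> \<open>The zero divisor shows that degree 0 does not pass vacuously, so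
      \<open>rank\<close> takes the branch with \<open>GREATEST\<close>.\<close>
    have "(\<lambda>_. 0) \<in> eff_divisors G 0"
      by (auto simp: eff_divisors_def deg_def effective_iff divisor_iff)
    then have ne: "subtractable G D 0 \<noteq> {}" using below[of 0] by auto
    have at: "subtractable G D k \<noteq> eff_divisors G k"
      using E k by (auto simp: subtractable_def eff_divisors_def)
    have "(GREATEST q. \<exists>k :: nat. q = of_nat k * global_unit G \<and>
        (\<forall>j\<le>k. subtractable G D j = eff_divisors G j)) = of_nat m * global_unit G"
    proof (rule Greatest_equality)
      fix q assume "\<exists>k :: nat. q = of_nat k * global_unit G \<and>
        (\<forall>j\<le>k. subtractable G D j = eff_divisors G j)"
      then obtain k' :: nat where k': "q = of_nat k' * global_unit G"
        "\<forall>j\<le>k'. subtractable G D j = eff_divisors G j" by blast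
      then have "k' \<le> m" using at Suc by (metis not_less_eq_eq)
      then show "q \<le> of_nat m * global_unit G" using k'(1) u by simp
    qed (use below in blast)
    then show ?thesis using ne k Suc by (simp add: rank_def algebra_simps)
  qed
qed

section \<open>Duality between a divisor and its canonical complement\<close>

text \<open>Let \<open>E'\<close> be effective and equivalent to \<open>\<nu> - (D - E)\<close>. If
  \<open>K - D - E'\<close> were equivalent to an effective divisor, adding \<open>E\<close> would
  make \<open>K - \<nu>\<close>, the divisor of the reversed order, equivalent to one as well. The
  degree of \<open>E'\<close> is the bound.\<close>

lemma minimal_obstruction_canonical_le:
  assumes D: "divisor G D" and E: "minimal_obstruction D E"
    and F: "minimal_obstruction (\<lambda>x. canonical G x - D x) F"
  shows "deg G F \<le> deg G E - deg G D - euler G"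
proof -
  have Eeff: "effective G E" and Eemp: "linear_system G (\<lambda>x. D x - E x) = {}"
    using E by (auto simp: minimal_obstruction_def)
  have "divisor G (\<lambda>x. D x - E x)" using D Eeff by (simp add: effective_iff divisor_diff)
  from order_divisor_minus_effective[OF this Eemp] obtain p f where p: "inj_on p (verts G)"
    and eff: "effective G (\<lambda>x. order_divisor G p x - (D x - E x) + laplacian G f x)" by blast
  define E' where "E' = (\<lambda>x. order_divisor G p x - (D x - E x) + laplacian G f x)"
  have "linear_system G (\<lambda>x. canonical G x - D x - E' x) = {}"
    unfolding linear_system_empty_iff
  proof (intro allI notI)
    fix g assume "effective G (\<lambda>x. canonical G x - D x - E' x + laplacian G g x)"
    then have "effective G (\<lambda>x. (canonical G x - D x - E' x + laplacian G g x) + E x)"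
      using Eeff by (auto simp: effective_iff intro: divisor_add)
    moreover have "(\<lambda>x. (canonical G x - D x - E' x + laplacian G g x) + E x)
        = (\<lambda>x. order_divisor G (\<lambda>x. - p x) x + laplacian G (\<lambda>x. g x + - f x) x)"
      by (simp only: laplacian_add laplacian_uminus order_divisor_reverse[OF p, symmetric])
        (simp add: E'_def fun_eq_iff)
    ultimately have "effective G (\<lambda>x. order_divisor G (\<lambda>x. - p x) x + laplacian G (\<lambda>x. g x + - f x) x)"
      by simp
    then show False
      using linear_system_order_divisor unfolding linear_system_empty_iff by blast
  qed
  then have "deg G F \<le> deg G E'"
    using F eff by (simp add: minimal_obstruction_def E'_def)
  also have "deg G E' = deg G E - deg G D - euler G"
    by (simp add: E'_def deg_add deg_diff deg_laplacian deg_order_divisor[OF p])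
  finally show ?thesis .
qed

text \<open>Since the canonical divisor has degree \<open>- 2 * euler G\<close>, the inequality for
  \<open>K - D\<close> is the reverse of the one for \<open>D\<close>; the global units in the two
  ranks cancel.\<close>

lemma riemann_roch:
  assumes D: "divisor G D"
  shows "rank G D - rank G (\<lambda>x. canonical G x - D x) = deg G D + euler G"
proof -
  let ?D' = "\<lambda>x. canonical G x - D x"
  obtain E F where E: "minimal_obstruction D E" and F: "minimal_obstruction ?D' F"
    using ex_minimal_obstruction by blast
  have "deg G F \<le> deg G E - deg G D - euler G"
    by (rule minimal_obstruction_canonical_le[OF D E F])
  moreover have "minimal_obstruction (\<lambda>x. canonical G x - ?D' x) E" using E by simp
  then have "deg G E \<le> deg G F - deg G ?D' - euler G"
    by (rule minimal_obstruction_canonical_le[OF divisor_diff[OF divisor_canonical D] F])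
  moreover have "deg G ?D' = - 2 * euler G - deg G D" by (simp add: deg_diff deg_canonical)
  ultimately show ?thesis
    using rank_eq_minimal_obstruction[OF E] rank_eq_minimal_obstruction[OF F] by linarith
qed

end

theorem theorem2p10:
  fixes G :: "'a wgraph" and D :: "'a \<Rightarrow> rat"
  assumes "weighted_graph G"
    and "divisor G D"
  shows "rank G D - rank G (\<lambda>x. canonical G x - D x) = deg G D + euler G"
  using assms by (rule riemann_roch)

end
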